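(* Let $Z$ be a complex circular normal random variable, with density $f_Z(z)=\frac1\pi e^{-|z|^2}$ on $\mathbb{C}$. Then the umbrae $A$ and $B$ defined by $A^mB^n=\delta_{m,n}\,m!$ for all $m,n\in\mathbb{N}$, or equivalently by $\exp(Ax+By)=\exp(xy)$ for all $x,y\in\mathbb{R}$, are identified with the expectations with respect to $Z$ and $\bar Z$ respectively; that is, $$E\left[Z^m\bar Z^n\right]=\delta_{m,n}\,m!\quad\text{for all } m,n\in\mathbb{N},$$ and equivalently $$E\exp\left(Zx+\bar Zy\right)=\exp(xy)\quad\text{for all } x,y\in\mathbb{R}.$$
   Context: $E$ denotes expectation, $\bar Z$ is the complex conjugate of $Z$, the density is with respect to Lebesgue measure on $\mathbb{C}\cong\mathbb{R}^2$, $\mathbb{N}$ includes $0$, and $\delta_{m,n}$ is the Kronecker delta. The umbrae $A,B$ are formal symbols evaluated linearly: in a polynomial or power series in $A,B$, each monomial $A^mB^n$ is replaced by $\delta_{m,n}m!$. Identifying them with expectations means that this evaluation of $A^mB^n$ coincides with $E[Z^m\bar Z^n]$. *)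

theory Defs
  imports "HOL-Probability.Probability" "HOL-Computational_Algebra.Formal_Power_Series"
begin

text \<open>
  Formal power series in two commuting symbols \<open>A\<close>, \<open>B\<close> over the complex numbers are
  represented as power series in \<open>A\<close> whose coefficients are power series in \<open>B\<close>, so that
  \<open>fps_nth (fps_nth F m) n\<close> is the coefficient of \<open>A^m B^n\<close> in \<open>F\<close>.
\<close>

type_synonym series2 = "complex fps fps"

definition symA :: series2 where
  "symA = fps_X"

definition symB :: series2 where
  "symB = fps_const fps_X"

definition scalar :: "complex \<Rightarrow> series2" where
  "scalar c = fps_const (fps_const c)"

abbreviation coeff2 :: "series2 \<Rightarrow> nat \<Rightarrow> nat \<Rightarrow> complex" where
  "coeff2 F m n \<equiv> fps_nth (fps_nth F m) n"

text \<open>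
  The exponential \<open>\<Sum>k. F^k / k!\<close>, taken coefficientwise.  If \<open>F\<close> has no constant
  term, each coefficient receives only finitely many nonzero contributions.
\<close>

definition formal_exp :: "series2 \<Rightarrow> series2" where
  "formal_exp F = Abs_fps (\<lambda>m. Abs_fps (\<lambda>n. \<Sum>k. coeff2 (F ^ k) m n / fact k))"

text \<open>
  A pair of umbrae is given by the numbers \<open>u m n\<close> that replace the monomials \<open>A^m B^n\<close>.
  The linear evaluation of a power series is a relation rather than a function, so that no
  value is assigned when the resulting double series fails to converge (unconditionally).
  For polynomials the sum is finite.
\<close>

definition umbral_value :: "(nat \<Rightarrow> nat \<Rightarrow> complex) \<Rightarrow> series2 \<Rightarrow> complex \<Rightarrow> bool" where
  "umbral_value u F v \<longleftrightarrow> ((\<lambda>(m, n). coeff2 F m n * u m n) has_sum v) UNIV"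

definition circular_umbra :: "nat \<Rightarrow> nat \<Rightarrow> complex" where
  "circular_umbra m n = (if m = n then fact m else 0)"

definition circular_normal_density :: "complex \<Rightarrow> real" where
  "circular_normal_density z = 1 / pi * exp (- (cmod z)\<^sup>2)"

end

theory Submission
  imports Defs "HOL-Complex_Analysis.Cauchy_Integral_Formula"
begin

text \<open>
  The coefficient of $A^m B^n$ in $\exp(Ax + By)$ is $x^m y^n / (m!\,n!)$, so the umbral
  value of that exponential is the exponential generating function of the numbers that
  replace the monomials.  For $\delta_{m,n}\,m!$ this double series collapses to its
  diagonal $\sum_n (xy)^n / n! = \exp(xy)$.  Conversely, a double power series that
  converges and vanishes for all real $x, y$ has only zero coefficients, since the
  one-variable identity theorem applies first in $x$ and then in $y$.  Hence the
  exponential identity determines all monomial values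
  (\<open>umbral_exp_determines\<close>), which is the equivalence of the two definitions
  of the umbrae.

  The same uniqueness delivers the moments of \<open>Z\<close>.  Writing $Z = S + iT$, one has
  $Zx + \bar Z y = (x + y) S + i (x - y) T$.  The density factors into two copies of
  $e^{-s^2}/\sqrt\pi$, and $\int e^{cs} e^{-s^2}/\sqrt\pi\,ds = e^{c^2/4}$ for every
  complex $c$.  This gives
  $E \exp(Zx + \bar Z y) = \exp(((x+y)^2 - (x-y)^2)/4) = \exp(xy)$.
  As $|Z|$ has all exponential moments, expectation and exponential series may be
  exchanged (\<open>exp_expectation_eq_moment_series\<close>).  Thus $E\,Z^m \bar Z^n$ and
  $\delta_{m,n}\,m!$ have the same umbral exponential, and they agree.
\<close>

section \<open>Umbral values of monomials and exponentials\<close>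

lemma coeff2_monomial:
  "coeff2 (symA ^ m * symB ^ n) i j = (if i = m \<and> j = n then 1 else 0)"
  by (auto simp: symA_def symB_def fps_const_power fps_X_power_mult_nth fps_X_power_nth
           split: if_splits)

text \<open>
  The symbols \<open>A\<close> and \<open>B\<close> commute, so this is the binomial theorem.  Each
  coefficient thus occurs in a single power, and the coefficientwise sum in the formal
  exponential reduces to one term.
\<close>

lemma coeff2_linear_power:
  "coeff2 ((symA * scalar x + symB * scalar y) ^ k) m n =
     (if k = m + n then of_nat (k choose m) * x ^ m * y ^ n else 0)"
proof -
  have "coeff2 ((symA * scalar x + symB * scalar y) ^ k) m n =
      (\<Sum>i\<le>k. coeff2 (of_nat (k choose i) * (symA * scalar x) ^ i * (symB * scalar y) ^ (k - i)) m n)"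
    by (subst binomial_ring) (simp add: fps_sum_nth)
  also have "\<dots> = (\<Sum>i\<le>k. if i = m then (if k - m = n then of_nat (k choose m) * x ^ m * y ^ n else 0) else 0)"
  proof (rule sum.cong[OF refl])
    fix i
    have "of_nat (k choose i) * (symA * scalar x) ^ i * (symB * scalar y) ^ (k - i)
        = (symA ^ i * symB ^ (k - i)) * scalar (of_nat (k choose i) * x ^ i * y ^ (k - i))"
      by (simp add: scalar_def power_mult_distrib fps_const_power fps_of_nat [symmetric] mult_ac
               flip: fps_const_mult)
    then show "coeff2 (of_nat (k choose i) * (symA * scalar x) ^ i * (symB * scalar y) ^ (k - i)) m n
        = (if i = m then (if k - m = n then of_nat (k choose m) * x ^ m * y ^ n else 0) else 0)"
      by (auto simp: scalar_def coeff2_monomial)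
  qed
  also have "\<dots> = (if k = m + n then of_nat (k choose m) * x ^ m * y ^ n else 0)"
    by (auto simp: sum.delta)
  finally show ?thesis .
qed

lemma coeff2_formal_exp_linear:
  "coeff2 (formal_exp (symA * scalar x + symB * scalar y)) m n = x ^ m / fact m * (y ^ n / fact n)"
proof -
  have "(\<lambda>k. coeff2 ((symA * scalar x + symB * scalar y) ^ k) m n / fact k)
      sums (of_nat ((m + n) choose m) * x ^ m * y ^ n / fact (m + n))"
    using sums_single[of "m + n" "\<lambda>k. of_nat (k choose m) * x ^ m * y ^ n / fact k"]
    by (simp add: coeff2_linear_power if_distrib[of "\<lambda>t. t / _"] cong: if_cong)
  then show ?thesis
    by (simp add: formal_exp_def sums_iff binomial_fact)
qed

lemma umbral_value_monomial:
  "umbral_value u (symA ^ m * symB ^ n) v \<longleftrightarrow> u m n = v"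
proof -
  have "((\<lambda>(i, j). coeff2 (symA ^ m * symB ^ n) i j * u i j) has_sum u m n) UNIV"
    by (rule has_sum_finite_neutralI[of "{(m, n)}"]) (auto simp: coeff2_monomial split: if_splits)
  then show ?thesis
    unfolding umbral_value_def by (auto intro: has_sum_unique)
qed

lemma exp_series_has_sum:
  fixes c :: "'a::{real_normed_field, banach}"
  shows "((\<lambda>n. c ^ n / fact n) has_sum exp c) UNIV"
  using norm_summable_imp_has_sum[OF summable_norm_exp exp_converges, of c]
  by (simp add: scaleR_conv_of_real field_simps)

lemma circular_umbra_exp_series:
  fixes x y :: complex
  shows "((\<lambda>(m, n). x ^ m / fact m * (y ^ n / fact n) * circular_umbra m n) has_sum exp (x * y)) UNIV"
proof -
  have "bij_betw (\<lambda>n::nat. (n, n)) UNIV {(m, n). m = n}"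
    by (auto simp: bij_betw_def inj_on_def)
  then have "((\<lambda>(m, n). (x * y) ^ m / fact m) has_sum exp (x * y)) {(m::nat, n). m = n}"
    using exp_series_has_sum[of "x * y"]
    by (subst has_sum_reindex_bij_betw[symmetric, where g = "\<lambda>n. (n, n)" and A = UNIV]) auto
  also have "?this \<longleftrightarrow> ?thesis"
    by (rule has_sum_cong_neutral)
      (auto simp: circular_umbra_def power_mult_distrib field_simps)
  finally show ?thesis .
qed

lemma umbral_exp_circular:
  "umbral_value circular_umbra (formal_exp (symA * scalar x + symB * scalar y)) (exp (x * y))"
  unfolding umbral_value_def coeff2_formal_exp_linear by (rule circular_umbra_exp_series)

section \<open>Uniqueness of the coefficients\<close>

text \<open>
  The series is only known to vanish on the real line, but its convergence at the point 1
  makes it analytic on the unit disc, and a nonzero analytic function has isolated zeros.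
\<close>

lemma powser_zero_on_reals_imp_coeff_zero:
  fixes a :: "nat \<Rightarrow> complex"
  assumes "\<And>x::real. (\<lambda>n. a n * of_real x ^ n) sums 0"
  shows "a n = 0"
proof (rule ccontr)
  assume an: "a n \<noteq> 0"
  have "a 0 = 0"
    using assms[of 0] by (simp add: powser_sums_zero_iff)
  then have n: "n > 0"
    using an by (cases n) auto
  have sums: "(\<lambda>n. a n * (z - 0) ^ n) sums (\<Sum>n. a n * z ^ n)" if "norm (z - 0) < 1" for z
  proof -
    have "summable (\<lambda>n. a n * z ^ n)"
      using powser_inside[of a 1 z] assms[of 1] that by (auto simp: sums_iff)
    then show ?thesis
      by (simp add: summable_sums)
  qed
  \<comment> \<open>The isolated zero at the origin excludes further zeros at small positive reals.\<close>
  obtain s where s: "s > 0" "\<And>z. z \<in> cball 0 s - {0} \<Longrightarrow> (\<Sum>n. a n * z ^ n) \<noteq> 0"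
    using powser_0_nonzero[OF zero_less_one sums _ an n] \<open>a 0 = 0\<close> by auto
  from s(2)[of "of_real s"] s(1) assms[of s] show False
    by (auto simp: sums_iff)
qed

text \<open>
  Unconditional convergence permits summing over \<open>n\<close> first.  For fixed \<open>y\<close>
  the result is a power series in \<open>x\<close>, so each of its coefficients, itself a power series
  in \<open>y\<close>, vanishes.
\<close>

lemma double_powser_zero_on_reals_imp_coeff_zero:
  fixes a :: "nat \<Rightarrow> nat \<Rightarrow> complex"
  assumes "\<And>x y::real. ((\<lambda>(m, n). a m n * of_real x ^ m * of_real y ^ n) has_sum 0) UNIV"
  shows "a m n = 0"
proof -
  have *: "((\<lambda>n. a m n * of_real y ^ n) has_sum 0) UNIV" for m and y :: real
  proof -
    define s where "s = (\<lambda>m. \<Sum>\<^sub>\<infinity>n. a m n * of_real y ^ n)"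
    have inner1: "(\<lambda>n. a m n * of_real y ^ n) summable_on UNIV" for m
    proof -
      \<comment> \<open>Setting \<open>x = 1\<close> removes the factor in \<open>x\<close> for every \<open>m\<close>.\<close>
      have "(\<lambda>(m, n). a m n * of_real 1 ^ m * of_real y ^ n) summable_on UNIV \<times> UNIV"
        using assms[of 1 y] by (auto simp: summable_on_def)
      from summable_on_SigmaD1[OF this, of m] show ?thesis by simp
    qed
    then have inner: "((\<lambda>n. a m n * of_real y ^ n) has_sum s m) UNIV" for m
      unfolding s_def by (rule has_sum_infsum)
    have "(\<lambda>m. s m * of_real x ^ m) sums 0" for x :: real
    proof (rule has_sum_imp_sums, rule has_sum_SigmaD)
      show "((\<lambda>(m, n). a m n * of_real x ^ m * of_real y ^ n) has_sum 0) (UNIV \<times> UNIV)"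
        using assms[of x y] by simp
      show "((\<lambda>n. case (m, n) of (m, n) \<Rightarrow> a m n * of_real x ^ m * of_real y ^ n)
          has_sum s m * of_real x ^ m) UNIV" for m
        using has_sum_cmult_left[OF inner[of m], of "of_real x ^ m"] by (simp add: mult_ac)
    qed
    from powser_zero_on_reals_imp_coeff_zero[OF this, of m] inner[of m] show ?thesis
      by simp
  qed
  show ?thesis
    by (rule powser_zero_on_reals_imp_coeff_zero) (rule has_sum_imp_sums, rule *)
qed

text \<open>
  The umbral exponential is an exponential generating function, so the difference of
  \<open>u\<close> and \<open>w\<close> yields a double power series that vanishes at all real points.
\<close>

lemma umbral_exp_determines:
  assumes "\<And>x y :: real. umbral_value u
     (formal_exp (symA * scalar (of_real x) + symB * scalar (of_real y))) (v x y)"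
    and "\<And>x y :: real. umbral_value w
     (formal_exp (symA * scalar (of_real x) + symB * scalar (of_real y))) (v x y)"
  shows "u = w"
proof (intro ext)
  fix m n
  have "(u m n - w m n) / (fact m * fact n) = 0"
  proof (rule double_powser_zero_on_reals_imp_coeff_zero[of "\<lambda>m n. (u m n - w m n) / (fact m * fact n)"])
    fix x y :: real
    from has_sum_add[OF assms(1)[of x y, unfolded umbral_value_def coeff2_formal_exp_linear]
        has_sum_uminusI[OF assms(2)[of x y, unfolded umbral_value_def coeff2_formal_exp_linear]]]
    show "((\<lambda>(m, n). (u m n - w m n) / (fact m * fact n) * of_real x ^ m * of_real y ^ n) has_sum 0) UNIV"
      by (simp add: case_prod_unfold field_simps)
  qed
  then show "u m n = w m n"
    by simp
qed

section \<open>Gaussian integrals of exponentials\<close>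

lemma std_normal_fourier:
  "has_bochner_integral lborel (\<lambda>s. std_normal_density s *\<^sub>R iexp (t * s)) (of_real (exp (- t\<^sup>2 / 2)))"
proof -
  have "integrable lborel (\<lambda>s. std_normal_density s *\<^sub>R iexp (t * s))"
    by (rule Bochner_Integration.integrable_bound[OF integrable_normal_density[of 1 0]])
      (auto simp: norm_exp_eq_Re)
  moreover have "(LINT s|lborel. std_normal_density s *\<^sub>R iexp (t * s)) = char std_normal_distribution t"
    unfolding char_def by (subst integral_density) auto
  ultimately show ?thesis
    by (simp add: has_bochner_integral_iff char_std_normal_distribution)
qed

text \<open>
  Completing the square in the real part \<open>a\<close> of \<open>c\<close> moves the centre of the
  Gaussian to \<open>a / 2\<close>.  What remains is the Fourier transform of a normal density, with
  frequency the imaginary part of \<open>c\<close>.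
\<close>

lemma gaussian_exp_integral:
  fixes c :: complex
  shows "has_bochner_integral lborel (\<lambda>s. (exp (- s\<^sup>2) / sqrt pi) *\<^sub>R exp (c * of_real s)) (exp (c\<^sup>2 / 4))"
proof -
  define a b where "a = Re c" and "b = Im c"
  \<comment> \<open>\<open>k\<close> collects the factors independent of \<open>s\<close> that the shift by \<open>a / 2\<close> leaves behind.\<close>
  define k where "k = exp (of_real (a\<^sup>2 / 4) + \<i> * of_real (a * b / 2))"
  \<comment> \<open>The substitution \<open>sqrt 2 * (s - a / 2)\<close> turns variance 1 into 1/2 and shifts the centre.\<close>
  have "has_bochner_integral lborel
     (\<lambda>s. std_normal_density (- a / sqrt 2 + sqrt 2 * s) *\<^sub>R iexp (b / sqrt 2 * (- a / sqrt 2 + sqrt 2 * s)))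
     (of_real (exp (- (b / sqrt 2)\<^sup>2 / 2)) /\<^sub>R \<bar>sqrt 2\<bar>)"
    by (subst lborel_has_bochner_integral_real_affine_iff[symmetric])
      (use std_normal_fourier[of "b / sqrt 2"] in simp_all)
  from has_bochner_integral_mult_right[OF has_bochner_integral_scaleR_right[OF this, of "sqrt 2"], of k]
  have "has_bochner_integral lborel
     (\<lambda>s. k * (sqrt 2 * std_normal_density (- a / sqrt 2 + sqrt 2 * s)) *\<^sub>R iexp (b / sqrt 2 * (- a / sqrt 2 + sqrt 2 * s)))
     (k * of_real (exp (- (b / sqrt 2)\<^sup>2 / 2)))"
    by simp
  also have "(\<lambda>s. k * (sqrt 2 * std_normal_density (- a / sqrt 2 + sqrt 2 * s)) *\<^sub>R iexp (b / sqrt 2 * (- a / sqrt 2 + sqrt 2 * s)))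
     = (\<lambda>s. (exp (- s\<^sup>2) / sqrt pi) *\<^sub>R exp (c * of_real s))"
  proof
    fix s :: real
    have 1: "b / sqrt 2 * (- a / sqrt 2 + sqrt 2 * s) = b * s - a * b / 2"
      by (simp add: field_simps)
    have 2: "(- a / sqrt 2 + sqrt 2 * s)\<^sup>2 / 2 = s\<^sup>2 + a\<^sup>2 / 4 - a * s"
      by (simp add: field_simps power2_eq_square)
    have 3: "sqrt 2 * std_normal_density (- a / sqrt 2 + sqrt 2 * s) = exp (- (s\<^sup>2 + a\<^sup>2 / 4 - a * s)) / sqrt pi"
      unfolding std_normal_density_def 2[symmetric] by (simp add: real_sqrt_mult)
    have 4: "k * of_real (exp (- (s\<^sup>2 + a\<^sup>2 / 4 - a * s))) * iexp (b * s - a * b / 2)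
        = of_real (exp (- s\<^sup>2)) * exp (c * of_real s)"
      unfolding k_def exp_of_real[symmetric] exp_add[symmetric]
      by (rule arg_cong[of _ _ exp]) (simp add: complex_eq_iff a_def b_def algebra_simps)
    have "k * (sqrt 2 * std_normal_density (- a / sqrt 2 + sqrt 2 * s)) *\<^sub>R iexp (b / sqrt 2 * (- a / sqrt 2 + sqrt 2 * s))
       = (k * of_real (exp (- (s\<^sup>2 + a\<^sup>2 / 4 - a * s))) * iexp (b * s - a * b / 2)) / of_real (sqrt pi)"
      unfolding 1 3 by (simp add: scaleR_conv_of_real)
    also have "\<dots> = (exp (- s\<^sup>2) / sqrt pi) *\<^sub>R exp (c * of_real s)"
      unfolding 4 by (simp add: scaleR_conv_of_real)
    finally show "k * (sqrt 2 * std_normal_density (- a / sqrt 2 + sqrt 2 * s)) *\<^sub>R iexp (b / sqrt 2 * (- a / sqrt 2 + sqrt 2 * s))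
       = (exp (- s\<^sup>2) / sqrt pi) *\<^sub>R exp (c * of_real s)" .
  qed
  also have "k * of_real (exp (- (b / sqrt 2)\<^sup>2 / 2)) = exp (c\<^sup>2 / 4)"
    unfolding k_def exp_of_real[symmetric] exp_add[symmetric]
    by (rule arg_cong[of _ _ exp]) (simp add: complex_eq_iff a_def b_def power2_eq_square)
  finally show ?thesis .
qed

lemma (in pair_sigma_finite) has_bochner_integral_pair_mult:
  fixes f :: "'a \<Rightarrow> 'c::{real_normed_field, banach, second_countable_topology}"
  assumes f: "has_bochner_integral M1 f a" and g: "has_bochner_integral M2 g b"
  shows "has_bochner_integral (M1 \<Otimes>\<^sub>M M2) (\<lambda>(x, y). f x * g y) (a * b)"
proof -
  have [measurable]: "f \<in> borel_measurable M1" "g \<in> borel_measurable M2"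
    using f g by (auto simp: has_bochner_integral_iff dest: borel_measurable_integrable)
  have int: "integrable (M1 \<Otimes>\<^sub>M M2) (\<lambda>(x, y). f x * g y)"
    using f g by (intro Fubini_integrable) (auto simp: norm_mult has_bochner_integral_iff)
  moreover have "(\<integral>(x, y). f x * g y \<partial>(M1 \<Otimes>\<^sub>M M2)) = a * b"
    using f g by (subst integral_fst[OF int, symmetric]) (auto simp: has_bochner_integral_iff)
  ultimately show ?thesis
    by (simp add: has_bochner_integral_iff)
qed

text \<open>
  This identification lets Fubini's theorem act on integrals over the complex plane.
\<close>

lemma lborel_complex_eq_distr:
  "lborel = distr (lborel \<Otimes>\<^sub>M lborel) borel (\<lambda>(s, t). Complex s t)"
proof (rule lborel_eqI)
  have [measurable]: "(\<lambda>(s, t). Complex s t) \<in> borel_measurable (lborel \<Otimes>\<^sub>M lborel)"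
    unfolding Complex_eq by measurable
  fix l u :: complex
  assume *: "\<And>b. b \<in> Basis \<Longrightarrow> l \<bullet> b \<le> u \<bullet> b"
  have le: "Re l \<le> Re u" "Im l \<le> Im u"
    using *[of 1] *[of \<i>] by (auto simp: Basis_complex_def)
  have "(\<lambda>(s, t). Complex s t) -` box l u = {Re l<..<Re u} \<times> {Im l<..<Im u}"
    by (auto simp: box_def Basis_complex_def)
  then show "emeasure (distr (lborel \<Otimes>\<^sub>M lborel) borel (\<lambda>(s, t). Complex s t)) (box l u)
      = (\<Prod>b\<in>Basis. (u - l) \<bullet> b)"
    using le by (simp add: emeasure_distr space_pair_measure lborel.emeasure_pair_measure_Times
        Basis_complex_def ennreal_mult)
qed simp

text \<open>
  The parameters are complex because $Zx + \bar Z y$ has an imaginary coefficient at the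
  imaginary part of \<open>Z\<close>; real parameters serve to bound exponential moments.
\<close>

lemma circular_normal_exp_integral:
  fixes a b :: complex
  shows "has_bochner_integral lborel
     (\<lambda>z. circular_normal_density z *\<^sub>R exp (a * of_real (Re z) + b * of_real (Im z)))
     (exp ((a\<^sup>2 + b\<^sup>2) / 4))"
proof -
  have [measurable]: "(\<lambda>(s, t). Complex s t) \<in> borel_measurable (lborel \<Otimes>\<^sub>M lborel)"
    unfolding Complex_eq by measurable
  have [measurable]: "Re \<in> borel_measurable borel" "Im \<in> borel_measurable borel"
    by (auto intro!: borel_measurable_continuous_onI continuous_intros)
  have density: "circular_normal_density (Complex s t) = exp (- s\<^sup>2) / sqrt pi * (exp (- t\<^sup>2) / sqrt pi)"
    for s t
    by (simp add: circular_normal_density_def cmod_power2 mult_exp_exp)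
  have "has_bochner_integral (lborel \<Otimes>\<^sub>M lborel)
     (\<lambda>(s, t). ((exp (- s\<^sup>2) / sqrt pi) *\<^sub>R exp (a * of_real s)) * ((exp (- t\<^sup>2) / sqrt pi) *\<^sub>R exp (b * of_real t)))
     (exp (a\<^sup>2 / 4) * exp (b\<^sup>2 / 4))"
    by (intro lborel_pair.has_bochner_integral_pair_mult gaussian_exp_integral)
  also have "(\<lambda>(s, t). ((exp (- s\<^sup>2) / sqrt pi) *\<^sub>R exp (a * of_real s)) * ((exp (- t\<^sup>2) / sqrt pi) *\<^sub>R exp (b * of_real t)))
     = (\<lambda>p. (\<lambda>z. circular_normal_density z *\<^sub>R exp (a * of_real (Re z) + b * of_real (Im z))) (case p of (s, t) \<Rightarrow> Complex s t))"
    by (simp add: fun_eq_iff density exp_add)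
  also have "exp (a\<^sup>2 / 4) * exp (b\<^sup>2 / 4) = exp ((a\<^sup>2 + b\<^sup>2) / 4)"
    by (simp add: exp_add[symmetric] add_divide_distrib)
  finally show ?thesis
    by (subst lborel_complex_eq_distr, intro has_bochner_integral_distr) (measurable, simp_all add: circular_normal_density_def)
qed

section \<open>Expectations of exponentials of a circular normal variable\<close>

lemma distributed_has_bochner_integral:
  fixes g :: "'b \<Rightarrow> 'c::{banach, second_countable_topology}"
  assumes X: "distributed M N X (\<lambda>x. ennreal (f x))" and f: "\<And>x. 0 \<le> f x"
    and [measurable]: "f \<in> borel_measurable N" "g \<in> borel_measurable N"
    and int: "has_bochner_integral N (\<lambda>x. f x *\<^sub>R g x) v"
  shows "has_bochner_integral M (\<lambda>\<omega>. g (X \<omega>)) v"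
proof -
  have [measurable]: "X \<in> measurable M N"
    using X by (rule distributed_measurable)
  have "has_bochner_integral (distr M N X) g v"
    unfolding distributed_distr_eq_density[OF X]
    using int f by (intro has_bochner_integral_density) auto
  then show ?thesis
    by (simp add: has_bochner_integral_iff integrable_distr_eq integral_distr)
qed

lemma circular_normal_exp_linear_expectation:
  fixes a b :: complex
  assumes "distributed M lborel Z (\<lambda>z. ennreal (circular_normal_density z))"
  shows "has_bochner_integral M (\<lambda>\<omega>. exp (a * of_real (Re (Z \<omega>)) + b * of_real (Im (Z \<omega>))))
     (exp ((a\<^sup>2 + b\<^sup>2) / 4))"
proof (rule distributed_has_bochner_integral[OF assms _ _ _ circular_normal_exp_integral])
  show "0 \<le> circular_normal_density z" for z
    by (simp add: circular_normal_density_def)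
  show "circular_normal_density \<in> borel_measurable lborel"
    unfolding circular_normal_density_def by simp
  have [measurable]: "Re \<in> borel_measurable borel" "Im \<in> borel_measurable borel"
    by (auto intro!: borel_measurable_continuous_onI continuous_intros)
  show "(\<lambda>z. exp (a * of_real (Re z) + b * of_real (Im z))) \<in> borel_measurable lborel"
    by measurable
qed

text \<open>
  Since $|Z| \<le> |S| + |T|$ for the real part $S$ and the imaginary part $T$, and
  $e^{|u|} \<le> e^u + e^{-u}$, the exponential of \<open>c |Z|\<close> is dominated by four
  exponentials of real linear forms in $S$ and $T$.
\<close>

lemma circular_normal_exp_cmod_integrable:
  fixes c :: real
  assumes Z: "distributed M lborel Z (\<lambda>z. ennreal (circular_normal_density z))"
  shows "integrable M (\<lambda>\<omega>. exp (c * cmod (Z \<omega>)))"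
proof -
  have [measurable]: "Z \<in> borel_measurable M"
    using distributed_measurable[OF Z] by simp
  have real_exp: "integrable M (\<lambda>\<omega>. exp (a * Re (Z \<omega>) + b * Im (Z \<omega>)))" for a b :: real
  proof -
    have "integrable M (\<lambda>\<omega>. complex_of_real (exp (a * Re (Z \<omega>) + b * Im (Z \<omega>))))"
      using circular_normal_exp_linear_expectation[OF Z, of a b]
      by (simp add: has_bochner_integral_iff flip: exp_of_real)
    then show ?thesis
      by (simp add: complex_of_real_integrable_eq)
  qed
  have bound: "exp (c * cmod z) \<le> exp (c * Re z + c * Im z) + exp (c * Re z + (- c) * Im z)
      + exp ((- c) * Re z + c * Im z) + exp ((- c) * Re z + (- c) * Im z)" for z
  proof -
    have pm: "exp (\<bar>c\<bar> * \<bar>t\<bar>) \<le> exp (c * t) + exp (- c * t)" for t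
      by (auto simp: abs_if add_increasing add_increasing2)
    have "c * cmod z \<le> \<bar>c\<bar> * (\<bar>Re z\<bar> + \<bar>Im z\<bar>)"
      by (intro mult_mono cmod_le) auto
    then have "exp (c * cmod z) \<le> exp (\<bar>c\<bar> * \<bar>Re z\<bar>) * exp (\<bar>c\<bar> * \<bar>Im z\<bar>)"
      by (simp add: exp_add[symmetric] distrib_left)
    also have "\<dots> \<le> (exp (c * Re z) + exp (- c * Re z)) * (exp (c * Im z) + exp (- c * Im z))"
      by (intro mult_mono pm) auto
    finally show ?thesis
      by (simp add: mult_exp_exp algebra_simps)
  qed
  show ?thesis
  proof (rule Bochner_Integration.integrable_bound)
    show "integrable M (\<lambda>\<omega>. exp (c * Re (Z \<omega>) + c * Im (Z \<omega>)) + exp (c * Re (Z \<omega>) + (- c) * Im (Z \<omega>))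
      + exp ((- c) * Re (Z \<omega>) + c * Im (Z \<omega>)) + exp ((- c) * Re (Z \<omega>) + (- c) * Im (Z \<omega>)))"
      by (intro Bochner_Integration.integrable_add real_exp)
    show "AE \<omega> in M. norm (exp (c * cmod (Z \<omega>))) \<le>
        norm (exp (c * Re (Z \<omega>) + c * Im (Z \<omega>)) + exp (c * Re (Z \<omega>) + (- c) * Im (Z \<omega>))
      + exp ((- c) * Re (Z \<omega>) + c * Im (Z \<omega>)) + exp ((- c) * Re (Z \<omega>) + (- c) * Im (Z \<omega>)))"
      unfolding real_norm_def abs_exp_cancel by (intro AE_I2 order_trans[OF bound abs_ge_self])
  qed measurable
qed

text \<open>
  The case $a = x + y$, $b = i (x - y)$, where $a^2 + b^2 = 4xy$.
\<close>

lemma circular_normal_exp_expectation: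
  fixes x y :: complex
  assumes "distributed M lborel Z (\<lambda>z. ennreal (circular_normal_density z))"
  shows "has_bochner_integral M (\<lambda>\<omega>. exp (Z \<omega> * x + cnj (Z \<omega>) * y)) (exp (x * y))"
proof -
  have "(x + y) * of_real (Re z) + \<i> * (x - y) * of_real (Im z) = z * x + cnj z * y" for z
    by (simp add: complex_eq_iff algebra_simps)
  moreover have "((x + y)\<^sup>2 + (\<i> * (x - y))\<^sup>2) / 4 = x * y"
    by (simp add: power2_eq_square algebra_simps)
  ultimately show ?thesis
    using circular_normal_exp_linear_expectation[OF assms, of "x + y" "\<i> * (x - y)"] by simp
qed

section \<open>Expansion of exponential expectations into moments\<close>

lemma exp_double_series:
  fixes a b :: "'a::{real_normed_field, banach}"
  shows "((\<lambda>(m, n). a ^ m / fact m * (b ^ n / fact n)) has_sum exp (a + b)) UNIV"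
proof -
  have "(\<lambda>(m, n). norm a ^ m / fact m * (norm b ^ n / fact n)) summable_on UNIV \<times> UNIV"
  proof (rule summable_on_SigmaI)
    show "((\<lambda>n. case (m, n) of (m, n) \<Rightarrow> norm a ^ m / fact m * (norm b ^ n / fact n))
        has_sum norm a ^ m / fact m * exp (norm b)) UNIV" for m
      unfolding prod.case by (rule has_sum_cmult_right[OF exp_series_has_sum])
    show "(\<lambda>m. norm a ^ m / fact m * exp (norm b)) summable_on UNIV"
      using has_sum_cmult_left[OF exp_series_has_sum[of "norm a"]] by (auto simp: summable_on_def)
  qed auto
  then have "(\<lambda>(m, n). a ^ m / fact m * (b ^ n / fact n)) abs_summable_on UNIV \<times> UNIV"
    by (simp add: case_prod_unfold norm_mult norm_divide norm_power)
  then have summable: "(\<lambda>(m, n). a ^ m / fact m * (b ^ n / fact n)) summable_on UNIV \<times> UNIV"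
    by (rule abs_summable_summable)
  have "((\<lambda>(m, n). a ^ m / fact m * (b ^ n / fact n)) has_sum exp a * exp b) (UNIV \<times> UNIV)"
  proof (rule has_sum_SigmaI[OF _ _ summable])
    show "((\<lambda>n. case (m, n) of (m, n) \<Rightarrow> a ^ m / fact m * (b ^ n / fact n))
        has_sum a ^ m / fact m * exp b) UNIV" for m
      unfolding prod.case by (rule has_sum_cmult_right[OF exp_series_has_sum])
    show "((\<lambda>m. a ^ m / fact m * exp b) has_sum exp a * exp b) UNIV"
      by (rule has_sum_cmult_left[OF exp_series_has_sum])
  qed
  then show ?thesis
    by (simp add: exp_add)
qed

text \<open>
  The terms of the double series have absolute values that sum to
  $\exp((|x|+|y|)\,|Z|)$.  Since this is integrable, expectation and summation commute.
\<close>

lemma exp_expectation_eq_moment_series: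
  fixes Z :: "'a \<Rightarrow> complex"
  assumes [measurable]: "Z \<in> borel_measurable M"
    and exp_int: "\<And>c::real. integrable M (\<lambda>\<omega>. exp (c * cmod (Z \<omega>)))"
  shows "integrable M (\<lambda>\<omega>. Z \<omega> ^ m * cnj (Z \<omega>) ^ n)"
    and "((\<lambda>(m, n). x ^ m / fact m * (y ^ n / fact n) * (LINT \<omega>|M. Z \<omega> ^ m * cnj (Z \<omega>) ^ n))
       has_sum (LINT \<omega>|M. exp (Z \<omega> * x + cnj (Z \<omega>) * y))) UNIV"
proof -
  have [measurable]: "(\<lambda>\<omega>. cnj (Z \<omega>)) \<in> borel_measurable M"
    by (rule borel_measurable_continuous_on[OF _ assms(1)]) (intro continuous_intros)
  have mom: "integrable M (\<lambda>\<omega>. Z \<omega> ^ m * cnj (Z \<omega>) ^ n)" for m n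
  proof (rule Bochner_Integration.integrable_bound)
    show "integrable M (\<lambda>\<omega>. fact (m + n) * exp (cmod (Z \<omega>)))"
      using exp_int[of 1] by simp
    have "r ^ (m + n) \<le> fact (m + n) * exp r" if "r \<ge> 0" for r :: real
      using finite_sum_le_has_sum[OF exp_series_has_sum[of r], of "{m + n}"] that
      by (simp add: field_simps)
    then show "AE \<omega> in M. norm (Z \<omega> ^ m * cnj (Z \<omega>) ^ n) \<le> norm (fact (m + n) * exp (cmod (Z \<omega>)))"
      by (auto simp: norm_mult norm_power power_add)
  qed measurable
  then show "integrable M (\<lambda>\<omega>. Z \<omega> ^ m * cnj (Z \<omega>) ^ n)" .
  \<comment> \<open>Pairs are enumerated as naturals, since termwise integration concerns a sequence of functions.\<close>
  define t where "t = (\<lambda>i \<omega>. case prod_decode i of (m, n) \<Rightarrow> (Z \<omega> * x) ^ m / fact m * ((cnj (Z \<omega>) * y) ^ n / fact n))"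
  have t_moment: "t i = (\<lambda>\<omega>. case prod_decode i of (m, n) \<Rightarrow>
      x ^ m / fact m * (y ^ n / fact n) * (Z \<omega> ^ m * cnj (Z \<omega>) ^ n))" for i
    by (simp add: t_def case_prod_unfold power_mult_distrib mult_ac)
  have t_int: "integrable M (t i)" for i
    unfolding t_moment using mom by (simp add: case_prod_unfold)
  have norm_t: "norm (t i \<omega>) = (case prod_decode i of (m, n) \<Rightarrow> (cmod (Z \<omega>) * cmod x) ^ m / fact m * ((cmod (Z \<omega>) * cmod y) ^ n / fact n))" for i \<omega>
    by (simp add: t_def case_prod_unfold norm_mult norm_divide norm_power)
  have reindex: "((\<lambda>i. f (prod_decode i)) has_sum v) UNIV \<longleftrightarrow> (f has_sum v) UNIV" for f and v :: "'z :: {comm_monoid_add,topological_space}"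
    by (rule has_sum_reindex_bij_betw) (rule bij_prod_decode)
  have norm_sum: "((\<lambda>i. norm (t i \<omega>)) has_sum exp ((cmod x + cmod y) * cmod (Z \<omega>))) UNIV" for \<omega>
    unfolding norm_t reindex
    using exp_double_series[of "cmod (Z \<omega>) * cmod x" "cmod (Z \<omega>) * cmod y"] by (simp add: algebra_simps)
  have t_sum: "((\<lambda>i. t i \<omega>) has_sum exp (Z \<omega> * x + cnj (Z \<omega>) * y)) UNIV" for \<omega>
    unfolding t_def reindex by (rule exp_double_series)
  have summable_norms: "summable (\<lambda>i. LINT \<omega>|M. norm (t i \<omega>))"
  proof (rule summableI_nonneg_bounded)
    fix k
    have "(\<Sum>i<k. LINT \<omega>|M. norm (t i \<omega>)) = (LINT \<omega>|M. (\<Sum>i<k. norm (t i \<omega>)))"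
      using t_int by (simp add: Bochner_Integration.integral_sum)
    also have "\<dots> \<le> (LINT \<omega>|M. exp ((cmod x + cmod y) * cmod (Z \<omega>)))"
      using t_int exp_int finite_sum_le_has_sum[OF norm_sum]
      by (intro integral_mono) auto
    finally show "(\<Sum>i<k. LINT \<omega>|M. norm (t i \<omega>)) \<le> (LINT \<omega>|M. exp ((cmod x + cmod y) * cmod (Z \<omega>)))" .
  qed simp
  have "(\<lambda>i. LINT \<omega>|M. t i \<omega>) sums (LINT \<omega>|M. (\<Sum>i. t i \<omega>))"
    using t_int summable_norms sums_summable[OF has_sum_imp_sums[OF norm_sum]]
    by (intro sums_integral) auto
  also have "(\<lambda>\<omega>. \<Sum>i. t i \<omega>) = (\<lambda>\<omega>. exp (Z \<omega> * x + cnj (Z \<omega>) * y))"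
    using t_sum by (auto intro!: sums_unique[symmetric] has_sum_imp_sums)
  finally have "(\<lambda>i. LINT \<omega>|M. t i \<omega>) sums (LINT \<omega>|M. exp (Z \<omega> * x + cnj (Z \<omega>) * y))" .
  moreover have "summable (\<lambda>i. norm (LINT \<omega>|M. t i \<omega>))"
    by (rule summable_comparison_test'[OF summable_norms, of 0]) (simp add: integral_norm_bound)
  ultimately have "((\<lambda>i. LINT \<omega>|M. t i \<omega>) has_sum (LINT \<omega>|M. exp (Z \<omega> * x + cnj (Z \<omega>) * y))) UNIV"
    by (intro norm_summable_imp_has_sum)
  also have "(\<lambda>i. LINT \<omega>|M. t i \<omega>) =
      (\<lambda>i. case prod_decode i of (m, n) \<Rightarrow> x ^ m / fact m * (y ^ n / fact n) * (LINT \<omega>|M. Z \<omega> ^ m * cnj (Z \<omega>) ^ n))"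
    unfolding t_moment by (simp add: case_prod_unfold)
  finally show "((\<lambda>(m, n). x ^ m / fact m * (y ^ n / fact n) * (LINT \<omega>|M. Z \<omega> ^ m * cnj (Z \<omega>) ^ n))
       has_sum (LINT \<omega>|M. exp (Z \<omega> * x + cnj (Z \<omega>) * y))) UNIV"
    unfolding reindex .
qed

section \<open>The circular normal umbrae\<close>

theorem proposition15:
  fixes M :: "'a measure" and Z :: "'a \<Rightarrow> complex"
  assumes "prob_space M"
    and "distributed M lborel Z (\<lambda>z. ennreal (circular_normal_density z))"
  shows "(\<forall>u. (\<forall>m n. umbral_value u (symA ^ m * symB ^ n) (if m = n then fact m else 0)) \<longleftrightarrow>
              (\<forall>x y :: real.
                 umbral_value u
                   (formal_exp (symA * scalar (of_real x) + symB * scalar (of_real y)))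
                   (of_real (exp (x * y)))))
       \<and> (\<forall>m n. integrable M (\<lambda>\<omega>. Z \<omega> ^ m * cnj (Z \<omega>) ^ n)
              \<and> umbral_value circular_umbra (symA ^ m * symB ^ n)
                  (LINT \<omega>|M. Z \<omega> ^ m * cnj (Z \<omega>) ^ n)
              \<and> (LINT \<omega>|M. Z \<omega> ^ m * cnj (Z \<omega>) ^ n) = (if m = n then fact m else 0))
       \<and> (\<forall>x y :: real.
              integrable M (\<lambda>\<omega>. exp (Z \<omega> * of_real x + cnj (Z \<omega>) * of_real y))
              \<and> umbral_value circular_umbra
                  (formal_exp (symA * scalar (of_real x) + symB * scalar (of_real y)))
                  (LINT \<omega>|M. exp (Z \<omega> * of_real x + cnj (Z \<omega>) * of_real y))
              \<and> (LINT \<omega>|M. exp (Z \<omega> * of_real x + cnj (Z \<omega>) * of_real y))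
                  = of_real (exp (x * y)))"
proof -
  let ?E = "\<lambda>x y. formal_exp (symA * scalar x + symB * scalar y)"
  note Z = assms(2)
  have Z_meas: "Z \<in> borel_measurable M"
    using distributed_measurable[OF Z] by simp
  note exp_int = circular_normal_exp_cmod_integrable[OF Z]
  have exp_Z: "has_bochner_integral M (\<lambda>\<omega>. exp (Z \<omega> * of_real x + cnj (Z \<omega>) * of_real y))
      (of_real (exp (x * y)))" for x y :: real
    using circular_normal_exp_expectation[OF Z, of "of_real x" "of_real y"]
    by (simp flip: exp_of_real)
  have circular_exp: "umbral_value circular_umbra (?E (of_real x) (of_real y)) (of_real (exp (x * y)))"
    for x y :: real
    using umbral_exp_circular[of "of_real x" "of_real y"] by (simp flip: exp_of_real)
  have "umbral_value (\<lambda>m n. LINT \<omega>|M. Z \<omega> ^ m * cnj (Z \<omega>) ^ n)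
      (?E (of_real x) (of_real y)) (of_real (exp (x * y)))" for x y :: real
    using exp_expectation_eq_moment_series(2)[OF Z_meas exp_int, of "of_real x" "of_real y"] exp_Z[of x y]
    by (simp add: umbral_value_def coeff2_formal_exp_linear has_bochner_integral_iff)
  then have moments: "(\<lambda>m n. LINT \<omega>|M. Z \<omega> ^ m * cnj (Z \<omega>) ^ n) = circular_umbra"
    using circular_exp by (rule umbral_exp_determines)
  have moment: "(LINT \<omega>|M. Z \<omega> ^ m * cnj (Z \<omega>) ^ n) = circular_umbra m n" for m n
    by (rule fun_cong[OF fun_cong[OF moments, of m], of n])
  have monomials_iff: "(\<forall>m n. umbral_value u (symA ^ m * symB ^ n) (if m = n then fact m else 0))
      \<longleftrightarrow> u = circular_umbra" for u
    unfolding umbral_value_monomial circular_umbra_def fun_eq_iff by (rule refl)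
  have exps_iff: "(\<forall>x y :: real. umbral_value u (?E (of_real x) (of_real y)) (of_real (exp (x * y))))
      \<longleftrightarrow> u = circular_umbra" for u
  proof
    assume "\<forall>x y :: real. umbral_value u (?E (of_real x) (of_real y)) (of_real (exp (x * y)))"
    then show "u = circular_umbra"
      using circular_exp by (intro umbral_exp_determines[where v = "\<lambda>x y. of_real (exp (x * y))"]) blast+
  qed (simp only: circular_exp simp_thms)
  show ?thesis
    unfolding monomials_iff exps_iff
  proof (intro conjI allI refl)
    fix m n
    show "integrable M (\<lambda>\<omega>. Z \<omega> ^ m * cnj (Z \<omega>) ^ n)"
      by (rule exp_expectation_eq_moment_series(1)[OF Z_meas exp_int])
    show "umbral_value circular_umbra (symA ^ m * symB ^ n) (LINT \<omega>|M. Z \<omega> ^ m * cnj (Z \<omega>) ^ n)"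
      unfolding moment umbral_value_monomial by (rule refl)
    show "(LINT \<omega>|M. Z \<omega> ^ m * cnj (Z \<omega>) ^ n) = (if m = n then fact m else 0)"
      unfolding moment circular_umbra_def by (rule refl)
  next
    fix x y :: real
    show "integrable M (\<lambda>\<omega>. exp (Z \<omega> * of_real x + cnj (Z \<omega>) * of_real y))"
      using exp_Z by (rule integrable.intros)
    show E: "(LINT \<omega>|M. exp (Z \<omega> * of_real x + cnj (Z \<omega>) * of_real y)) = of_real (exp (x * y))"
      using exp_Z by (rule has_bochner_integral_integral_eq)
    show "umbral_value circular_umbra (?E (of_real x) (of_real y))
        (LINT \<omega>|M. exp (Z \<omega> * of_real x + cnj (Z \<omega>) * of_real y))"
      unfolding E by (rule circular_exp)
  qed
qed

end
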